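(* Let $m \ge 7$. Let $F \subseteq \mathcal{C}_m$ be a non-degenerate face of the Kunz cone with $\dim F = d$ and embedding dimension $\mathsf{e}(F) = e$. If either (a) $d = \tfrac12 m - 1$ and $e = m-2$; or (b) $d = 1$ and $e = m-3$, then $m$ is even and $F$ is not Apéry.
   Context: Kunz cone. For an integer $m \ge 2$ write $\mathbb{Z}_m = \mathbb{Z}/m\mathbb{Z}$. The Kunz cone $\mathcal{C}_m \subseteq \mathbb{R}_{\ge 0}^{m-1}$, with coordinates indexed by $\mathbb{Z}_m \setminus \{0\}$, is the pointed rational polyhedral cone of all $x$ with $x_i + x_j \ge x_{i+j}$ for all $i,j \in \mathbb{Z}_m\setminus\{0\}$ with $i+j \ne 0$. Faces of $\mathcal{C}_m$ are its (nonempty) faces in the usual sense for polyhedral cones, i.e. intersections of facets, with $\mathcal{C}_m$ itself included; $\dim F = \dim_{\mathbb{R}} \operatorname{span}_{\mathbb{R}} F$. The interior $F^\circ$ of a face $F$ is the set of points of $F$ not lying in any face properly contained in $F$. A face $F$ is degenerate if some $x \in F^\circ$ has some coordinate $x_i = 0$, and non-degenerate otherwise. Apéry faces. An Apéry point is an integer point $(z_1,\ldots,z_{m-1}) \in \mathbb{Z}^{m-1}$ with $z_i \equiv i \bmod m$ for each $i$. A face $F$ is Apéry if $F^\circ$ contains an Apéry point. Kunz nilsemigroup. For a non-degenerate face $F \subseteq \mathcal{C}_m$, pick $x \in F^\circ$ and set $x_0 = 0$. The Kunz nilsemigroup of $F$ is $N = \mathbb{Z}_m \cup \{\infty\}$ with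 the commutative operation $\oplus$ for which $\infty$ is nil ($a \oplus \infty = \infty$ for all $a$) and, for $a,b \in \mathbb{Z}_m$, $a \oplus b = a+b$ if $x_a + x_b = x_{a+b}$ and $a \oplus b = \infty$ otherwise. It does not depend on the choice of $x \in F^\circ$. The atoms of $N$ are the elements that cannot be written as a sum of two non-identity elements. The embedding dimension $\mathsf{e}(F)$ is the number of atoms of $N$. *)

theory Defs
  imports
    "HOL-Analysis.Analysis"
    "HOL-Algebra.Group"
    "HOL-Library.Function_Algebras"
begin

text \<open>
  The library provides pointwise addition on functions but no scalar multiplication.  With the
  instance below, the library's \<open>span\<close>, \<open>dim\<close> and \<open>face_of\<close> apply to sets of functions
  \<open>nat \<Rightarrow> real\<close>.
\<close>

instantiation "fun" :: (type, real_vector) real_vector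
begin

definition scaleR_fun :: "real \<Rightarrow> ('a \<Rightarrow> 'b) \<Rightarrow> 'a \<Rightarrow> 'b"
  where "scaleR_fun c f = (\<lambda>x. c *\<^sub>R f x)"

instance
  by standard (simp_all add: scaleR_fun_def fun_eq_iff scaleR_add_right scaleR_add_left)

end

lemma scaleR_fun_apply [simp]: "(c *\<^sub>R f) x = c *\<^sub>R f x"
  by (simp add: scaleR_fun_def)

text \<open>
  The residues modulo \<open>m\<close> are represented by \<open>0, \<dots>, m - 1\<close>, and a point of $\mathbb{R}^{m-1}$ is a
  function \<open>nat \<Rightarrow> real\<close> that vanishes outside \<open>{1..<m}\<close>.  In particular the convention $x_0 = 0$
  is built in.
\<close>

definition kunz_cone :: "nat \<Rightarrow> (nat \<Rightarrow> real) set"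
  where "kunz_cone m =
    {x. (\<forall>i. i \<notin> {1..<m} \<longrightarrow> x i = 0) \<and>
        (\<forall>i\<in>{1..<m}. 0 \<le> x i) \<and>
        (\<forall>i\<in>{1..<m}. \<forall>j\<in>{1..<m}. (i + j) mod m \<noteq> 0 \<longrightarrow> x i + x j \<ge> x ((i + j) mod m))}"

text \<open>The empty set satisfies \<open>face_of\<close>, so it has to be excluded.\<close>

definition kunz_face :: "nat \<Rightarrow> (nat \<Rightarrow> real) set \<Rightarrow> bool"
  where "kunz_face m F \<longleftrightarrow> F face_of kunz_cone m \<and> F \<noteq> {}"

definition face_interior :: "nat \<Rightarrow> (nat \<Rightarrow> real) set \<Rightarrow> (nat \<Rightarrow> real) set"
  where "face_interior m F = {x \<in> F. \<forall>G. kunz_face m G \<and> G \<subset> F \<longrightarrow> x \<notin> G}"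

definition degenerate_face :: "nat \<Rightarrow> (nat \<Rightarrow> real) set \<Rightarrow> bool"
  where "degenerate_face m F \<longleftrightarrow> (\<exists>x\<in>face_interior m F. \<exists>i\<in>{1..<m}. x i = 0)"

definition apery_point :: "nat \<Rightarrow> (nat \<Rightarrow> real) \<Rightarrow> bool"
  where "apery_point m z \<longleftrightarrow>
    (\<forall>i. i \<notin> {1..<m} \<longrightarrow> z i = 0) \<and>
    (\<forall>i\<in>{1..<m}. \<exists>k::int. z i = of_int k \<and> k mod int m = int i mod int m)"

definition apery_face :: "nat \<Rightarrow> (nat \<Rightarrow> real) set \<Rightarrow> bool"
  where "apery_face m F \<longleftrightarrow> (\<exists>z\<in>face_interior m F. apery_point m z)"

text \<open>
  The nil element \<open>\<infinity>\<close> is \<open>None\<close>.  The operation does not depend on the interior point that is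
  picked; since \<open>x 0 = 0\<close>, the identity is \<open>Some 0\<close>.
\<close>

definition kunz_nilsemigroup :: "nat \<Rightarrow> (nat \<Rightarrow> real) set \<Rightarrow> nat option monoid"
  where "kunz_nilsemigroup m F =
    (let x = (SOME x. x \<in> face_interior m F) in
      \<lparr>carrier = insert None (Some ` {0..<m}),
       mult = (\<lambda>u v. case (u, v) of
           (Some a, Some b) \<Rightarrow>
             (if x a + x b = x ((a + b) mod m) then Some ((a + b) mod m) else None)
         | _ \<Rightarrow> None),
       one = Some 0\<rparr>)"

text \<open>
  As usual, the identity itself is not an atom, although in a Kunz nilsemigroup it is not a
  product of two non-identity elements either.
\<close>

definition atoms :: "('a, 'b) monoid_scheme \<Rightarrow> 'a set"
  where "atoms N =
    {a \<in> carrier N - {\<one>\<^bsub>N\<^esub>}.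
       \<not> (\<exists>u\<in>carrier N - {\<one>\<^bsub>N\<^esub>}. \<exists>v\<in>carrier N - {\<one>\<^bsub>N\<^esub>}. a = u \<otimes>\<^bsub>N\<^esub> v)}"

definition embedding_dim :: "nat \<Rightarrow> (nat \<Rightarrow> real) set \<Rightarrow> nat"
  where "embedding_dim m F = card (atoms (kunz_nilsemigroup m F))"

end

theory Submission
  imports Defs
begin

text \<open>
  Let \<open>x\<close> be an interior point of \<open>F\<close>, and call a pair of nonzero residues \<open>a, b\<close> a tie if
  \<open>x\<^sub>a + x\<^sub>b = x\<^bsub>a+b\<^esub>\<close>.  Small steps from \<open>x\<close> in any direction that preserves all ties stay in \<open>F\<close>, so the
  solutions of the tie equations lie in the span of \<open>F\<close>, and \<open>m - 1\<close> is at most \<open>dim F\<close> plus the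
  number of unordered ties (\<open>dim_plus_ties_ge\<close>).  On the other hand, every tie has as its sum one of the
  \<open>m - 1 - e\<close> nonzero residues that are not atoms (\<open>card_decomposables\<close>), and the ties with sum \<open>c\<close>
  are few: their number is at most \<open>(A + H) / 2\<close>, where \<open>A \<le> m - 2\<close> counts the residues that have a
  partner in such a tie and \<open>H\<close> counts those that are their own partner (\<open>card_fibre_le\<close>).  Two residues
  \<open>a\<close> that are their own partner have the same coordinate \<open>x\<^sub>c / 2\<close> and can exist only if \<open>m\<close> is
  even, while the coordinates of an Apery point are distinct.

  In case (a) there is one sum \<open>c\<close> and there are at least \<open>m / 2\<close> ties, whence \<open>H \<ge> 2\<close>.  Since ties
  do not depend on the interior point, no interior point is an Apery point.

  In case (b) there are two sums \<open>p, q\<close> and at least \<open>m - 2\<close> ties.  Suppose that \<open>m\<close> is odd or that \<open>x\<close>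
  is an Apery point.  Then \<open>H \<le> 1\<close> for both sums, and counting shows that at most two of the
  equations \<open>x\<^sub>a + x\<^bsub>p-a\<^esub> = x\<^sub>p\<close> and \<open>x\<^sub>a + x\<^bsub>q-a\<^esub> = x\<^sub>q\<close>, with \<open>a\<close> any residue, fail.  Subtracting equations,
  translation by \<open>p - q\<close> adds the constant \<open>x\<^sub>p - x\<^sub>q\<close> to the coordinates, except at two residues.  As
  a nonzero constant cannot be added all the way round a cycle, every orbit of the translation
  contains an exception.  This determines the coordinates so completely that one of them would fail to
  be positive, or a third residue would fail to be an atom
  (\<open>all_but_one_tight_impossible\<close>, \<open>two_loops_missing_impossible\<close>).
\<close>

section \<open>Kernels of finitely many linear functionals\<close>

text \<open>
  One linear condition lowers the dimension by at most one: if \<open>f b \<noteq> 0\<close>, every \<open>y\<close> is the sum of a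
  multiple of \<open>b\<close> and of the vector \<open>y - (f y / f b) b\<close> of the kernel.  Dimensions are counted with
  explicit finite bases, so that ambient spaces of infinite dimension, such as spaces of functions, are
  covered.
\<close>

lemma kernel_basis_step:
  fixes B :: "'a::real_vector set"
  assumes "finite B" "independent B" "linear f"
  obtains B' where "finite B'" "independent B'" "B' \<subseteq> span B" "\<And>y. y \<in> B' \<Longrightarrow> f y = (0::real)"
    "card B \<le> card B' + 1"
proof -
  obtain B' where B': "B' \<subseteq> span B \<inter> {y. f y = 0}" "independent B'" "span B \<inter> {y. f y = 0} \<subseteq> span B'"
    using real_vector.maximal_independent_subset[of "span B \<inter> {y. f y = 0}"] by metis
  have fin: "finite B'"
    using real_vector.independent_span_bound[OF assms(1) B'(2)] B'(1) by blast
  obtain b where b: "B \<subseteq> span (insert b B')"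
  proof (cases "\<exists>b\<in>B. f b \<noteq> 0")
    case True
    then obtain b where b: "b \<in> B" "f b \<noteq> 0" by blast
    have "y \<in> span (insert b B')" if "y \<in> B" for y
    proof -
      have "f (y - (f y / f b) *\<^sub>R b) = 0"
        using b by (simp add: linear_diff[OF assms(3)] linear_cmul[OF assms(3)])
      moreover have "y - (f y / f b) *\<^sub>R b \<in> span B"
        using b that by (intro real_vector.span_diff real_vector.span_scale real_vector.span_base)
      ultimately have "y - (f y / f b) *\<^sub>R b \<in> span (insert b B')"
        using B'(3) real_vector.span_mono[of B' "insert b B'"] by blast
      then have "(y - (f y / f b) *\<^sub>R b) + (f y / f b) *\<^sub>R b \<in> span (insert b B')"
        by (intro real_vector.span_add) (auto intro: real_vector.span_scale real_vector.span_base)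
      then show ?thesis by simp
    qed
    then show ?thesis using that by blast
  next
    case False
    then have "B \<subseteq> span B'" using B'(3) real_vector.span_superset[of B] by blast
    then show ?thesis using that[of 0] real_vector.span_mono[of B' "insert 0 B'"] by blast
  qed
  have "card B \<le> card (insert b B')"
    using real_vector.independent_span_bound[OF _ assms(2) b] fin by simp
  also have "\<dots> \<le> card B' + 1" using fin by (simp add: card_insert_if)
  finally show ?thesis using that[of B'] B' fin by blast
qed

lemma kernel_basis:
  fixes B :: "'a::real_vector set"
  assumes "finite \<Phi>" "\<And>f. f \<in> \<Phi> \<Longrightarrow> linear f" "finite B" "independent B"
  shows "\<exists>B'. finite B' \<and> independent B' \<and> B' \<subseteq> span B \<and> (\<forall>f\<in>\<Phi>. \<forall>y\<in>B'. f y = (0::real))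
    \<and> card B \<le> card B' + card \<Phi>"
  using assms(1,2)
proof (induction \<Phi> rule: finite_induct)
  case empty
  show ?case using assms real_vector.span_superset[of B] by (intro exI[of _ B]) auto
next
  case (insert g \<Phi>)
  then obtain B1 where B1: "finite B1" "independent B1" "B1 \<subseteq> span B" "\<forall>f\<in>\<Phi>. \<forall>y\<in>B1. f y = 0"
    "card B \<le> card B1 + card \<Phi>" by auto
  obtain B2 where B2: "finite B2" "independent B2" "B2 \<subseteq> span B1" "\<And>y. y \<in> B2 \<Longrightarrow> g y = 0"
    "card B1 \<le> card B2 + 1"
    using kernel_basis_step[OF B1(1,2), of g] insert.prems by auto
  have "f y = 0" if "f \<in> \<Phi>" "y \<in> B2" for f y
    using real_vector.linear_eq_0_on_span[of f B1 y] insert.prems[of f] B1(4) B2(3) that by auto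
  moreover have "B2 \<subseteq> span B"
    using B2(3) real_vector.span_mono[OF B1(3)] real_vector.span_span[of B] by auto
  ultimately show ?case using B1 B2 insert.hyps by (intro exI[of _ B2]) auto
qed

section \<open>Faces of polyhedral cones\<close>

text \<open>
  The cone is cut out inside a subspace \<open>V\<close> so that the constraints need not be doubled to express
  linear equations that all its points satisfy.
\<close>

locale polyhedral_cone =
  fixes V :: "'a::real_vector set" and C :: "('a \<Rightarrow> real) set"
  assumes subspace_V: "subspace V"
    and finite_C: "finite C"
    and linear_C: "\<phi> \<in> C \<Longrightarrow> linear \<phi>"
begin

definition cone :: "'a set" where "cone = {x \<in> V. \<forall>\<phi>\<in>C. 0 \<le> \<phi> x}"

definition tight :: "'a \<Rightarrow> ('a \<Rightarrow> real) set" where "tight x = {\<phi> \<in> C. \<phi> x = 0}"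

text \<open>
  Strict constraints survive a small step in any direction, and the tight ones are unaffected by \<open>v\<close>.
\<close>

lemma perturb:
  assumes "x \<in> cone" "v \<in> V" "\<And>\<phi>. \<phi> \<in> tight x \<Longrightarrow> \<phi> v = 0"
  obtains t where "t > 0" "x + t *\<^sub>R v \<in> cone" "x - t *\<^sub>R v \<in> cone"
proof -
  have "\<forall>\<^sub>F t in at_right 0. t * \<bar>\<phi> v\<bar> \<le> \<phi> x" if "\<phi> \<in> C" for \<phi>
  proof (cases "\<phi> x = 0")
    case True
    then show ?thesis using assms(3)[of \<phi>] that by (simp add: tight_def)
  next
    case False
    then have pos: "\<phi> x > 0" using assms(1) that by (force simp: cone_def)
    have "((\<lambda>t. t * \<bar>\<phi> v\<bar>) \<longlongrightarrow> 0 * \<bar>\<phi> v\<bar>) (at_right 0)" by (intro tendsto_intros)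
    then have "\<forall>\<^sub>F t in at_right 0. t * \<bar>\<phi> v\<bar> < \<phi> x" using pos by (intro order_tendstoD) auto
    then show ?thesis by (rule eventually_mono) simp
  qed
  then have "\<forall>\<^sub>F t in at_right 0. \<forall>\<phi>\<in>C. t * \<bar>\<phi> v\<bar> \<le> \<phi> x"
    using finite_C by (simp add: eventually_ball_finite)
  moreover have "\<forall>\<^sub>F t in at_right (0::real). t > 0" by (simp add: eventually_at_right_less)
  ultimately have "\<forall>\<^sub>F t in at_right 0. t > 0 \<and> (\<forall>\<phi>\<in>C. t * \<bar>\<phi> v\<bar> \<le> \<phi> x)"
    by eventually_elim simp
  then obtain t where t: "t > 0" "\<forall>\<phi>\<in>C. t * \<bar>\<phi> v\<bar> \<le> \<phi> x"
    using eventually_happens trivial_limit_at_right_real by blast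
  have "\<bar>t * \<phi> v\<bar> \<le> \<phi> x" if "\<phi> \<in> C" for \<phi>
    using t that by (simp add: abs_mult)
  then have "0 \<le> \<phi> x + t * \<phi> v" "0 \<le> \<phi> x - t * \<phi> v" if "\<phi> \<in> C" for \<phi>
    using that by (smt (verit) abs_ge_self abs_ge_minus_self)+
  moreover have "x \<in> V" using assms(1) by (simp add: cone_def)
  ultimately show ?thesis using that[OF t(1)] assms(2) subspace_V
    by (simp add: cone_def linear_C linear_add linear_diff linear_cmul
        real_vector.subspace_add real_vector.subspace_diff real_vector.subspace_scale)
qed

text \<open>
  The point \<open>x\<close> is the midpoint of \<open>x - t v\<close> and \<open>x + t v\<close>, which both lie in the cone for small \<open>t\<close>,
  so a face that contains \<open>x\<close> contains these two points as well.
\<close>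

lemma tangent_in_span_face:
  assumes "F face_of cone" "x \<in> F" "v \<in> V" "\<And>\<phi>. \<phi> \<in> tight x \<Longrightarrow> \<phi> v = 0"
  shows "v \<in> span F"
proof (cases "v = 0")
  case True
  then show ?thesis by (simp add: real_vector.span_zero)
next
  case False
  have "x \<in> cone" using assms by (auto simp: face_of_def)
  then obtain t where t: "t > 0" "x + t *\<^sub>R v \<in> cone" "x - t *\<^sub>R v \<in> cone"
    using perturb assms(3,4) by blast
  have "x = (1 - 1/2) *\<^sub>R (x - t *\<^sub>R v) + (1/2) *\<^sub>R (x + t *\<^sub>R v)"
    by (simp add: algebra_simps flip: scaleR_add_left)
  moreover have "x - t *\<^sub>R v \<noteq> x + t *\<^sub>R v"
  proof
    assume "x - t *\<^sub>R v = x + t *\<^sub>R v"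
    then have "(2 * t) *\<^sub>R v = 0" by (simp add: algebra_simps flip: scaleR_2)
    then show False using False t by simp
  qed
  ultimately have "x \<in> open_segment (x - t *\<^sub>R v) (x + t *\<^sub>R v)"
    unfolding in_segment by (intro conjI exI[of _ "1/2::real"]) auto
  then have "x + t *\<^sub>R v \<in> F" using assms(1,2) t by (auto simp: face_of_def)
  then have "(1/t) *\<^sub>R ((x + t *\<^sub>R v) - x) \<in> span F"
    using assms(2) by (intro real_vector.span_scale real_vector.span_diff real_vector.span_base)
  then show ?thesis using t by simp
qed

text \<open>
  Each tight constraint removes at most one dimension from \<open>V\<close>, and what remains lies in the span of
  the face.
\<close>

lemma dim_face_ge:
  assumes F: "F face_of cone" "x \<in> F" and E: "finite E" "independent E" "span E = V"
  shows "card E \<le> dim F + card (tight x)"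
proof -
  have "finite (tight x)" "\<And>\<phi>. \<phi> \<in> tight x \<Longrightarrow> linear \<phi>"
    using finite_C linear_C by (auto simp: tight_def)
  from kernel_basis[OF this E(1,2)] obtain B where B: "finite B" "independent B" "B \<subseteq> V"
    "\<forall>\<phi>\<in>tight x. \<forall>y\<in>B. \<phi> y = 0" "card E \<le> card B + card (tight x)" using E(3) by auto
  have "B \<subseteq> span F" using tangent_in_span_face[OF F] B(3,4) by blast
  moreover obtain D where D: "D \<subseteq> F" "independent D" "F \<subseteq> span D" "card D = dim F"
    using real_vector.basis_exists by blast
  moreover have "finite D"
    using real_vector.independent_span_bound[OF E(1) D(2)] D(1) F(1) E(3)
    by (auto simp: face_of_def cone_def)
  moreover have "span F \<subseteq> span D" using real_vector.span_minimal[OF D(3)] by simp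
  ultimately have "card B \<le> dim F"
    using real_vector.independent_span_bound[of D B] B(2) by auto
  then show ?thesis using B(5) by simp
qed

text \<open>
  The relative interior of a face, expressed through the face lattice instead of a topology on \<open>V\<close>.
\<close>

definition relint :: "'a set \<Rightarrow> 'a set" where
  "relint F = {x \<in> F. \<forall>G. G face_of cone \<and> G \<noteq> {} \<and> G \<subset> F \<longrightarrow> x \<notin> G}"

text \<open>
  A convex combination, with positive coefficients, of two nonnegative numbers vanishes only if both
  of them do.
\<close>

lemma tight_segment:
  assumes "a \<in> cone" "b \<in> cone" "x \<in> open_segment a b"
  shows "tight x = tight a \<inter> tight b"
proof -
  obtain u where u: "0 < u" "u < 1" "x = (1 - u) *\<^sub>R a + u *\<^sub>R b"
    using assms(3) by (auto simp: in_segment)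
  have "\<phi> x = 0 \<longleftrightarrow> \<phi> a = 0 \<and> \<phi> b = 0" if "\<phi> \<in> C" for \<phi>
  proof -
    have "\<phi> x = (1 - u) * \<phi> a + u * \<phi> b"
      using linear_C[OF that] by (simp add: u(3) linear_add linear_cmul)
    moreover have "0 \<le> (1 - u) * \<phi> a" "0 \<le> u * \<phi> b"
      using assms(1,2) u that by (auto simp: cone_def)
    ultimately show ?thesis using u by (auto simp: add_nonneg_eq_0_iff)
  qed
  then show ?thesis by (auto simp: tight_def)
qed

text \<open>
  The points of \<open>F\<close> at which all constraints of \<open>tight x\<close> are tight form a face that contains \<open>x\<close>;
  it cannot be smaller than \<open>F\<close>.  In particular all interior points have the same tight constraints.
\<close>

lemma tight_relint_subset:
  assumes "F face_of cone" "x \<in> relint F" "y \<in> F"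
  shows "tight x \<subseteq> tight y"
proof -
  define G where "G = {z \<in> F. tight x \<subseteq> tight z}"
  have FC: "F \<subseteq> cone" using assms by (simp add: face_of_def)
  have "G face_of cone"
    unfolding face_of_def
  proof (intro conjI ballI impI)
    show "G \<subseteq> cone" using FC by (auto simp: G_def)
    have "convex F" using assms by (simp add: face_of_def)
    moreover have "\<phi> (u *\<^sub>R a + v *\<^sub>R b) = 0" if "\<phi> \<in> C" "\<phi> a = 0" "\<phi> b = 0" for \<phi> u v a b
      using that by (simp add: linear_C linear_add linear_cmul)
    ultimately show "convex G"
      by (auto simp: G_def convex_def tight_def subset_iff)
  next
    fix a b z assume *: "a \<in> cone" "b \<in> cone" "z \<in> G" "z \<in> open_segment a b"
    have "a \<in> F \<and> b \<in> F" using * assms(1) unfolding face_of_def G_def by blast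
    then show "a \<in> G" "b \<in> G" using tight_segment[OF *(1,2,4)] * by (auto simp: G_def)
  qed
  moreover have "x \<in> G" using assms by (simp add: G_def relint_def)
  ultimately have "\<not> G \<subset> F" using assms by (auto simp: relint_def)
  then have "G = F" by (auto simp: G_def)
  then show ?thesis using assms(3) by (auto simp: G_def)
qed

text \<open>
  A point \<open>x\<close> of \<open>F\<close> with as few tight constraints as possible is interior.  Passing to a midpoint
  with \<open>y\<close> intersects the sets of tight constraints, so those at \<open>x\<close> are tight at every \<open>y\<close> in \<open>F\<close>;
  hence the segment from \<open>y\<close> to \<open>x\<close> can be prolonged beyond \<open>x\<close> inside the cone, and every face
  through \<open>x\<close> contains \<open>y\<close>.
\<close>

lemma relint_nonempty:
  assumes F: "F face_of cone" "F \<noteq> {}"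
  shows "relint F \<noteq> {}"
proof -
  have FC: "F \<subseteq> cone" "convex F" using assms by (auto simp: face_of_def)
  obtain x where x: "x \<in> F" "\<And>y. y \<in> F \<Longrightarrow> card (tight x) \<le> card (tight y)"
    using ex_has_least_nat[of "\<lambda>x. x \<in> F" _ "\<lambda>x. card (tight x)"] F(2) by blast
  have min: "tight x \<subseteq> tight y" if "y \<in> F" for y
  proof (cases "x = y")
    case False
    have fin: "finite (tight x)" using finite_C by (simp add: tight_def)
    have mid: "midpoint x y \<in> open_segment x y" using False by simp
    then have "midpoint x y \<in> F"
      using closed_segment_subset[OF x(1) that FC(2)] by (auto simp: open_segment_def)
    then have "card (tight x) \<le> card (tight x \<inter> tight y)"
      using x(2) tight_segment[OF _ _ mid] x(1) that FC by (metis subsetD)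
    then have "tight x \<inter> tight y = tight x"
      using fin by (intro card_seteq) auto
    then show ?thesis by blast
  qed simp
  have "F \<subseteq> G" if G: "G face_of cone" "x \<in> G" for G
  proof
    fix y assume y: "y \<in> F"
    show "y \<in> G"
    proof (cases "y = x")
      case True then show ?thesis using G by simp
    next
      case False
      have "x \<in> cone" "y \<in> cone" using x y FC by auto
      moreover have "y - x \<in> V"
        using calculation subspace_V by (simp add: cone_def real_vector.subspace_diff)
      moreover have "\<phi> (y - x) = 0" if "\<phi> \<in> tight x" for \<phi>
        using min[OF y] that linear_C by (auto simp: tight_def linear_diff)
      ultimately obtain t where t: "t > 0" "x - t *\<^sub>R (y - x) \<in> cone"
        using perturb by metis
      define z where "z = x - t *\<^sub>R (y - x)"
      have "x = (1 - t/(1+t)) *\<^sub>R z + (t/(1+t)) *\<^sub>R y"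
      proof -
        have "(1 + t) *\<^sub>R ((1 - t/(1+t)) *\<^sub>R z + (t/(1+t)) *\<^sub>R y) = z + t *\<^sub>R y"
          using t by (simp add: scaleR_add_right field_simps)
        also have "\<dots> = (1 + t) *\<^sub>R x" by (simp add: z_def algebra_simps)
        finally show ?thesis using t by simp
      qed
      moreover have "z \<noteq> y"
      proof
        assume "z = y"
        then have "(1 + t) *\<^sub>R (y - x) = 0" by (simp add: z_def algebra_simps)
        then show False using t False by simp
      qed
      ultimately have "x \<in> open_segment z y"
        using t unfolding in_segment by (intro conjI exI[of _ "t/(1+t)"]) auto
      then show ?thesis using G t y FC unfolding z_def face_of_def by blast
    qed
  qed
  then have "x \<in> relint F" using x(1) by (auto simp: relint_def)
  then show ?thesis by blast
qed

end

section \<open>Weights on residues that translation changes by a constant\<close>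

text \<open>
  A function \<open>X\<close> on the integers that depends only on the residue modulo \<open>m\<close>, vanishes at the residue
  \<open>0\<close> and is positive at the others.  With integer arguments, subtraction and multiplication by a unit
  need no reduction modulo \<open>m\<close>.
\<close>

locale residue_weight =
  fixes m :: int and X :: "int \<Rightarrow> real"
  assumes m_ge: "7 \<le> m"
    and cong: "m dvd a - b \<Longrightarrow> X a = X b"
    and zero: "X 0 = 0"
    and pos: "\<not> m dvd a \<Longrightarrow> 0 < X a"
begin

lemma not_dvd_small: "0 < \<bar>k\<bar> \<Longrightarrow> \<bar>k\<bar> < m \<Longrightarrow> \<not> m dvd k"
  using dvd_imp_le_int[of k m] m_ge by auto

lemma residue_avoiding:
  assumes "int (length ss) < m"
  shows "\<exists>b. \<forall>s\<in>set ss. \<not> m dvd b - s"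
proof -
  let ?R = "(\<lambda>s. s mod m) ` set ss"
  have "card ?R \<le> length ss"
    using card_image_le[of "set ss" "\<lambda>s. s mod m"] card_length[of ss] by simp
  then have "\<not> {0..<m} \<subseteq> ?R"
    using card_mono[of ?R "{0..<m}"] assms by auto
  then obtain b where b: "b \<in> {0..<m}" "b \<notin> ?R" by blast
  have "\<not> m dvd b - s" if "s \<in> set ss" for s
  proof
    assume "m dvd b - s"
    then have "s mod m = b" using b(1) by (simp flip: mod_eq_dvd_iff)
    then show False using b(2) that by blast
  qed
  then show ?thesis by blast
qed

text \<open>
  Suppose that translation by \<open>\<delta>\<close> adds a fixed amount \<open>\<epsilon> \<noteq> 0\<close> to \<open>X\<close> except at the residues \<open>s\<close>
  and \<open>t\<close>.  An orbit that avoids them would return to its start after \<open>m\<close> steps with a value changed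
  by \<open>m \<epsilon>\<close>.
\<close>

lemma translation_hits_exception:
  assumes "\<epsilon> \<noteq> 0"
    and step: "\<And>b. \<not> m dvd b - s \<Longrightarrow> \<not> m dvd b - t \<Longrightarrow> X (b + \<delta>) = X b + \<epsilon>"
  shows "\<exists>i::nat. m dvd b + int i * \<delta> - s \<or> m dvd b + int i * \<delta> - t"
proof (rule ccontr)
  assume none: "\<not> ?thesis"
  have "X (b + int n * \<delta>) = X b + real n * \<epsilon>" for n
  proof (induction n)
    case (Suc n)
    have "X (b + int n * \<delta> + \<delta>) = X (b + int n * \<delta>) + \<epsilon>"
      using none by (intro step) blast+
    then show ?case using Suc by (simp add: algebra_simps)
  qed simp
  from this[of "nat m"] have "X (b + m * \<delta>) = X b + real_of_int m * \<epsilon>" using m_ge by simp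
  moreover have "X (b + m * \<delta>) = X b" by (intro cong) simp
  ultimately show False using assms(1) m_ge by simp
qed

text \<open>
  If step and exceptions are all multiples of \<open>\<delta>\<close>, the orbit of \<open>1\<close> reaches a multiple of \<open>\<delta>\<close>, so
  that \<open>1\<close> itself is one modulo \<open>m\<close>.
\<close>

lemma translation_imp_coprime:
  assumes "\<epsilon> \<noteq> 0"
    and "\<And>b. \<not> m dvd b - k * \<delta> \<Longrightarrow> \<not> m dvd b - l * \<delta> \<Longrightarrow> X (b + n * \<delta>) = X b + \<epsilon>"
  shows "coprime m \<delta>"
proof (rule coprimeI)
  fix g assume g: "g dvd m" "g dvd \<delta>"
  obtain i :: nat where
    "m dvd 1 + int i * (n * \<delta>) - k * \<delta> \<or> m dvd 1 + int i * (n * \<delta>) - l * \<delta>"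
    using translation_hits_exception[OF assms, where b = 1] by blast
  then have "g dvd 1 + (int i * n - k) * \<delta> \<or> g dvd 1 + (int i * n - l) * \<delta>"
    using g(1) by (auto simp: algebra_simps intro: dvd_trans)
  then show "is_unit g" using g(2) by (metis dvd_add_left_iff dvd_mult)
qed

text \<open>
  Subtracting the equations of \<open>p\<close> and \<open>q\<close> gives \<open>X (b + \<delta>) = X b + \<epsilon>\<close> for \<open>\<delta> = p - q\<close> and
  \<open>\<epsilon> = X p - X q\<close>, unless \<open>b\<close> is \<open>- \<delta>\<close> or \<open>p\<close>.  From \<open>b = 0\<close> one finds \<open>X \<delta> = \<epsilon>\<close> and
  \<open>X (2 \<delta>) = 2 \<epsilon>\<close>, so \<open>\<delta> + \<delta>\<close> is a tie and its sum must be \<open>p\<close> or \<open>q\<close>.  Thus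
  \<open>q = k \<delta>\<close> and \<open>p = (k + 1) \<delta>\<close> with \<open>k \<in> {1, 2}\<close>, and \<open>\<delta>\<close> is a unit modulo \<open>m\<close>.  Up to that unit,
  \<open>X\<close> grows in steps of \<open>\<epsilon>\<close> on \<open>0, \<dots>, k + 1\<close> and again on \<open>k + 2, \<dots>, m - 1\<close>.  The equation
  \<open>X (k + 2) + X (m - 1) = X (k + 1)\<close> then leaves room for a positive \<open>X (k + 2)\<close> only if \<open>k = 2\<close> and
  \<open>m = 7\<close>, where \<open>4 + 4 = 1\<close> is a tie whose sum is neither \<open>p\<close> nor
  \<open>q\<close>.
\<close>

lemma all_but_one_tight_impossible:
  assumes p: "\<not> m dvd p" and q: "\<not> m dvd q" and pq: "\<not> m dvd p - q" and ge: "X q \<le> X p"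
    and P: "\<And>a. X a + X (p - a) = X p"
    and Q: "\<And>a. \<not> m dvd a - p \<Longrightarrow> \<not> m dvd a - (q - p) \<Longrightarrow> X a + X (q - a) = X q"
    and nonatom: "\<And>a b. \<not> m dvd a \<Longrightarrow> \<not> m dvd b \<Longrightarrow> X a + X b = X (a + b) \<Longrightarrow>
      m dvd a + b - p \<or> m dvd a + b - q"
  shows False
proof -
  define \<delta> where "\<delta> = p - q"
  define \<epsilon> where "\<epsilon> = X p - X q"
  have step: "X (b + \<delta>) = X b + \<epsilon>" if "\<not> m dvd b + \<delta>" "\<not> m dvd b - p" for b
  proof -
    \<comment> \<open>The two excluded arguments of the equation for \<open>q\<close> become those of the translation.\<close>
    have "q - b - p = - (b + \<delta>)" "q - b - (q - p) = - (b - p)" by (simp_all add: \<delta>_def)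
    then have "\<not> m dvd q - b - p" "\<not> m dvd q - b - (q - p)"
      using that by (simp_all only: dvd_minus_iff not_False_eq_True)
    then have "X (q - b) + X b = X q" using Q[of "q - b"] by simp
    moreover have "X (q - b) + X (b + \<delta>) = X p"
      using P[of "q - b"] by (simp add: \<delta>_def algebra_simps)
    ultimately show ?thesis by (simp add: \<epsilon>_def)
  qed
  have \<delta>: "\<not> m dvd \<delta>" using pq by (simp add: \<delta>_def)
  have X1: "X \<delta> = \<epsilon>" using step[of 0] \<delta> p by (simp add: zero)
  then have \<epsilon>: "\<epsilon> > 0" using pos[OF \<delta>] by simp
  have not2: "\<not> m dvd 2 * \<delta>"
  proof
    assume m2: "m dvd 2 * \<delta>"
    \<comment> \<open>Neither \<open>b\<close> nor \<open>b + \<delta>\<close> is exceptional, so going there and back adds \<open>2 \<epsilon>\<close>.\<close>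
    obtain b where b: "\<not> m dvd b" "\<not> m dvd b + \<delta>" "\<not> m dvd b - p" "\<not> m dvd b - q"
      using residue_avoiding[of "[0, -\<delta>, p, q]"] m_ge by auto
    have "X (b + \<delta> + \<delta>) = X (b + \<delta>) + \<epsilon>"
    proof (rule step)
      show "\<not> m dvd b + \<delta> + \<delta>"
        using b(1) m2 dvd_add_left_iff[of m "2 * \<delta>" b] by (simp add: algebra_simps)
      show "\<not> m dvd b + \<delta> - p" using b(4) by (simp add: \<delta>_def)
    qed
    moreover have "X (b + \<delta> + \<delta>) = X b" using m2 by (intro cong) simp
    ultimately show False using step[OF b(2,3)] \<epsilon> by simp
  qed
  have "X (2 * \<delta>) = 2 * \<epsilon>"
    using step[of \<delta>] X1 not2 q by (simp add: \<delta>_def)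
  then have "m dvd 2 * \<delta> - p \<or> m dvd 2 * \<delta> - q" using nonatom[of \<delta> \<delta>] \<delta> X1 by simp
  then obtain k where k: "k = 1 \<or> k = 2" "m dvd p - (k + 1) * \<delta>"
  proof
    assume "m dvd 2 * \<delta> - p"
    then have "m dvd p - (1 + 1) * \<delta>" by (simp add: dvd_diff_commute)
    then show ?thesis using that[of 1] by simp
  next
    assume "m dvd 2 * \<delta> - q"
    then have "m dvd p - (2 + 1) * \<delta>" by (simp add: \<delta>_def dvd_diff_commute algebra_simps)
    then show ?thesis using that[of 2] by simp
  qed
  \<comment> \<open>Both exceptions \<open>- \<delta>\<close> and \<open>p\<close> are now multiples of \<open>\<delta>\<close>.\<close>
  have "m dvd b - p \<longleftrightarrow> m dvd b - (k + 1) * \<delta>" for b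
    using k(2) dvd_add_left_iff[of m "p - (k + 1) * \<delta>" "b - p"] by simp
  then have cop: "coprime m \<delta>"
    using step \<epsilon> by (intro translation_imp_coprime[of \<epsilon> "-1" \<delta> "k + 1" 1]) auto
  define Y where "Y j = X (j * \<delta>)" for j
  have dvd: "m dvd j * \<delta> \<longleftrightarrow> m dvd j" for j
    using cop by (simp add: coprime_dvd_mult_left_iff)
  have Ystep: "Y (j + 1) = Y j + \<epsilon>" if "\<not> m dvd j + 1" "\<not> m dvd j - (k + 1)" for j
  proof -
    have "\<not> m dvd j * \<delta> - p"
      using that(2) dvd[of "j - (k + 1)"] k(2)
        dvd_add_left_iff[of m "p - (k + 1) * \<delta>" "j * \<delta> - p"] by (simp add: algebra_simps)
    then show ?thesis using step[of "j * \<delta>"] that(1) dvd[of "j + 1"] by (simp add: Y_def algebra_simps)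
  qed
  have YP: "Y a + Y (k + 1 - a) = Y (k + 1)" for a
  proof -
    have "X (p - a * \<delta>) = Y (k + 1 - a)" "X p = Y (k + 1)"
      using k(2) unfolding Y_def by (auto intro!: cong simp: algebra_simps)
    then show ?thesis using P[of "a * \<delta>"] by (simp add: Y_def)
  qed
  have Y0: "Y 0 = 0" by (simp add: Y_def zero)
  have Y1: "Y 1 = \<epsilon>" using X1 by (simp add: Y_def)
  have Y2: "Y 2 = 2 * \<epsilon>" using \<open>X (2 * \<delta>) = 2 * \<epsilon>\<close> by (simp add: Y_def)
  have Yk: "Y (k + 1) = (k + 1) * \<epsilon>"
    using k(1) Ystep[of 2] Y2 m_ge not_dvd_small[of 3] not_dvd_small[of "-1"] by auto
  have far: "Y (k + 2 + int t) = Y (k + 2) + t * \<epsilon>" if "k + 2 + int t < m" for t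
    using that
  proof (induction t)
    case (Suc t)
    have "Y (k + 2 + int t + 1) = Y (k + 2 + int t) + \<epsilon>"
      using Suc.prems k(1) by (intro Ystep not_dvd_small) auto
    then show ?case using Suc by (simp add: algebra_simps)
  qed simp
  have "Y (m - 1) = Y (k + 2) + (m - k - 3) * \<epsilon>"
    using far[of "nat (m - k - 3)"] m_ge k(1) by auto
  moreover have "Y (k + 1 - (k + 2)) = Y (m - 1)"
    unfolding Y_def by (intro cong) (simp add: algebra_simps)
  ultimately have "2 * Y (k + 2) = (2 * k + 4 - m) * \<epsilon>"
    using YP[of "k + 2"] Yk by (simp add: algebra_simps)
  moreover have "Y (k + 2) > 0"
    unfolding Y_def using dvd[of "k + 2"] not_dvd_small[of "k + 2"] k(1) m_ge by (intro pos) auto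
  ultimately have "0 < real_of_int (2 * k + 4 - m) * \<epsilon>" by simp
  then have "real_of_int (2 * k + 4 - m) > 0" using \<epsilon> by (rule zero_less_mult_pos2)
  then have "2 * k + 4 > m" by linarith
  then have km: "k = 2" "m = 7" using m_ge k(1) by auto
  have "2 * Y 4 = \<epsilon>" using \<open>2 * Y (k + 2) = _\<close> km by simp
  moreover have "X (8 * \<delta>) = X \<delta>" by (rule cong) (simp add: km)
  ultimately have "X (4 * \<delta>) + X (4 * \<delta>) = X (4 * \<delta> + 4 * \<delta>)" using X1 by (simp add: Y_def)
  then have "7 dvd 8 * \<delta> - p \<or> 7 dvd 8 * \<delta> - q"
    using nonatom[of "4 * \<delta>" "4 * \<delta>"] dvd[of 4] by (simp add: km)
  moreover have "7 dvd p - 3 * \<delta>" "7 dvd q - 2 * \<delta>" using k(2) by (simp_all add: km \<delta>_def algebra_simps)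
  ultimately have "7 dvd (8 * \<delta> - p) + (p - 3 * \<delta>) \<or> 7 dvd (8 * \<delta> - q) + (q - 2 * \<delta>)"
    using dvd_add by blast
  then have "7 dvd 5 * \<delta> \<or> 7 dvd 6 * \<delta>" by (simp add: algebra_simps)
  then show False using dvd[of 5] dvd[of 6] by (simp add: km)
qed

text \<open>
  Here the translation is by \<open>2 r - 4 r = - 2 r\<close>, with the exceptions \<open>3 r\<close> and \<open>2 r\<close>; so \<open>r\<close> is a
  unit modulo \<open>m\<close>.  Starting from \<open>0\<close>, the tie \<open>(- 2 r) + (- 2 r) = - 4 r\<close> must land on \<open>2 r\<close> or
  \<open>4 r\<close>, which forces \<open>m = 8\<close>.  Then \<open>X (2 r) = 3 \<epsilon>\<close>, whereas
  \<open>X (2 r) = 2 X (- 3 r) = 2 X r + 4 \<epsilon>\<close>.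
\<close>

lemma two_loops_missing_impossible:
  assumes neq: "X (2 * r) \<noteq> X (4 * r)"
    and P: "\<And>a. \<not> m dvd a - r \<Longrightarrow> X a + X (2 * r - a) = X (2 * r)"
    and Q: "\<And>a. \<not> m dvd a - 2 * r \<Longrightarrow> X a + X (4 * r - a) = X (4 * r)"
    and nonatom: "\<And>a b. \<not> m dvd a \<Longrightarrow> \<not> m dvd b \<Longrightarrow> X a + X b = X (a + b) \<Longrightarrow>
      m dvd a + b - 2 * r \<or> m dvd a + b - 4 * r"
  shows False
proof -
  define \<epsilon> where "\<epsilon> = X (2 * r) - X (4 * r)"
  have step: "X (b + (-2) * r) = X b + \<epsilon>" if "\<not> m dvd b - 3 * r" "\<not> m dvd b - 2 * r" for b
  proof -
    have "X (4 * r - b) + X b = X (4 * r)"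
      using Q[of "4 * r - b"] that by (simp add: dvd_diff_commute)
    moreover have "X (4 * r - b) + X (b + (-2) * r) = X (2 * r)"
      using P[of "4 * r - b"] that by (simp add: dvd_diff_commute algebra_simps)
    ultimately show ?thesis by (simp add: \<epsilon>_def)
  qed
  have "\<epsilon> \<noteq> 0" using neq by (simp add: \<epsilon>_def)
  then have cop: "coprime m r" using translation_imp_coprime[OF _ step] by blast
  define Y where "Y j = X (j * r)" for j
  have dvd: "m dvd j * r \<longleftrightarrow> m dvd j" for j
    using cop by (simp add: coprime_dvd_mult_left_iff)
  have Ystep: "Y (j - 2) = Y j + \<epsilon>" if "\<not> m dvd j - 3" "\<not> m dvd j - 2" for j
    using step[of "j * r"] that dvd[of "j - 3"] dvd[of "j - 2"] by (simp add: Y_def algebra_simps)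
  have Y2: "Y (-2) = \<epsilon>" using Ystep[of 0] m_ge by (simp add: Y_def zero not_dvd_small)
  have Y4: "Y (-4) = 2 * \<epsilon>" using Ystep[of "-2"] m_ge Y2 by (simp add: not_dvd_small)
  have "m dvd (-4) * r - 2 * r \<or> m dvd (-4) * r - 4 * r"
    using nonatom[of "(-2) * r" "(-2) * r"] Y2 Y4 dvd[of "-2"] m_ge
    by (simp add: Y_def not_dvd_small)
  then have "m dvd 6 \<or> m dvd 8"
    using dvd[of "-6"] dvd[of "-8"] by (simp add: algebra_simps)
  then have "m \<le> 8" using m_ge zdvd_imp_le[of m 8] not_dvd_small[of 6] by auto
  moreover have "m \<noteq> 7" using \<open>m dvd 6 \<or> m dvd 8\<close> by auto
  ultimately have m: "m = 8" using m_ge by simp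
  have "Y (-6) = 3 * \<epsilon>" using Ystep[of "-4"] Y4 by (simp add: m)
  moreover have "Y (-6) = Y 2" unfolding Y_def by (intro cong) (simp add: m)
  moreover have "Y (-1) = Y 1 + \<epsilon>" using Ystep[of 1] by (simp add: m)
  moreover have "Y (-3) = Y (-1) + \<epsilon>" using Ystep[of "-1"] by (simp add: m)
  moreover have "Y (-3) + Y 5 = Y 2"
    using P[of "(-3) * r"] dvd[of "-4"] by (simp add: Y_def m algebra_simps)
  moreover have "Y 5 = Y (-3)" unfolding Y_def by (intro cong) (simp add: m)
  moreover have "Y 1 > 0" "Y (-2) > 0" unfolding Y_def using dvd[of 1] dvd[of "-2"] by (auto intro!: pos simp: m)
  ultimately show False using Y2 by simp
qed

end

section \<open>Counting ties\<close>

context residue_weight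
begin

definition tight_pairs :: "(int \<times> int) set" where
  "tight_pairs = {(a, b). a \<in> {1..<m} \<and> b \<in> {1..<m} \<and> a \<le> b \<and> X a + X b = X (a + b)}"

definition decomposables :: "int set" where
  "decomposables = (\<lambda>(a, b). (a + b) mod m) ` tight_pairs"

text \<open>
  The equation \<open>X a + X (c - a) = X c\<close> holds trivially for \<open>a = 0\<close> and \<open>a = c\<close>; the other residues are
  divided into those that satisfy it and the defects.
\<close>

definition summands :: "int \<Rightarrow> int set" where
  "summands c = {a \<in> {1..<m}. a \<noteq> c \<and> X a + X (c - a) = X c}"

definition defects :: "int \<Rightarrow> int set" where
  "defects c = {a \<in> {1..<m}. a \<noteq> c \<and> X a + X (c - a) \<noteq> X c}"

definition halves :: "int \<Rightarrow> int set" where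
  "halves c = {a \<in> summands c. m dvd 2 * a - c}"

lemma finite_defects [simp]: "finite (defects c)"
  and finite_summands [simp]: "finite (summands c)"
  and finite_halves [simp]: "finite (halves c)"
  unfolding defects_def summands_def halves_def by (rule finite_subset[of _ "{1..<m}"]; auto)+

lemma finite_tight_pairs [simp]: "finite tight_pairs"
  by (rule finite_subset[of _ "{1..<m} \<times> {1..<m}"]) (auto simp: tight_pairs_def)

lemma X_mod: "X (a mod m) = X a"
  by (intro cong) (simp flip: mod_eq_dvd_iff)

lemma mod_in_range: "\<not> m dvd a \<Longrightarrow> a mod m \<in> {1..<m}"
  using m_ge by (simp add: dvd_eq_mod_eq_0 order.not_eq_order_implies_strict zle_add1_eq_le
      pos_mod_sign[of m a] pos_mod_bound[of m a] int_one_le_iff_zero_less)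

lemma not_dvd_range: "a \<in> {1..<m} \<Longrightarrow> \<not> m dvd a"
  by (intro not_dvd_small) auto

lemma not_dvd_diff: "a \<in> {1..<m} \<Longrightarrow> b \<in> {1..<m} \<Longrightarrow> a \<noteq> b \<Longrightarrow> \<not> m dvd a - b"
  by (intro not_dvd_small) auto

lemma card_summands_defects:
  assumes "c \<in> {1..<m}"
  shows "int (card (summands c) + card (defects c)) = m - 2"
proof -
  have "summands c \<union> defects c = {1..<m} - {c}" "summands c \<inter> defects c = {}"
    by (auto simp: summands_def defects_def)
  then have "card (summands c) + card (defects c) = card ({1..<m} - {c})"
    by (metis card_Un_disjoint finite_summands finite_defects)
  also have "\<dots> = nat (m - 1) - 1" using assms by simp
  finally show ?thesis using m_ge by simp
qed

text \<open>
  The two entries of a tie with sum \<open>c\<close> are summands of \<open>c\<close>, and an entry that occurs both as a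
  smaller and as a larger one is a half of \<open>c\<close>.
\<close>

lemma card_fibre_le:
  assumes c: "c \<in> {1..<m}"
  shows "2 * card {t \<in> tight_pairs. (fst t + snd t) mod m = c} \<le> card (summands c) + card (halves c)"
    (is "2 * card ?T \<le> _")
proof -
  have T: "a \<in> {1..<m}" "b \<in> {1..<m}" "a \<le> b" "X a + X b = X c" "m dvd a + b - c"
    if "(a, b) \<in> ?T" for a b
  proof -
    have "X (a + b) = X c" using that X_mod[of "a + b"] by simp
    then show "a \<in> {1..<m}" "b \<in> {1..<m}" "a \<le> b" "X a + X b = X c" "m dvd a + b - c"
      using that c by (auto simp: tight_pairs_def simp flip: mod_eq_dvd_iff)
  qed
  have uniq: "b = b'" if "m dvd a + b - c" "m dvd a + b' - c" "b \<in> {1..<m}" "b' \<in> {1..<m}" for a b b'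
    using not_dvd_diff[OF that(3,4)] dvd_diff[OF that(1,2)] by auto
  have "a \<in> summands c \<and> b \<in> summands c" if t: "(a, b) \<in> ?T" for a b
  proof -
    have "X (c - a) = X b" "X (c - b) = X a"
      using T(5)[OF t] by (auto intro!: cong simp: dvd_diff_commute algebra_simps)
    moreover have "a \<noteq> c" "b \<noteq> c"
      using T(5)[OF t] not_dvd_range T(1,2)[OF t] by auto
    ultimately show ?thesis using T[OF t] by (auto simp: summands_def)
  qed
  then have union: "fst ` ?T \<union> snd ` ?T \<subseteq> summands c" by fastforce
  have "a \<in> halves c" if "(a, b) \<in> ?T" "(b', a) \<in> ?T" for a b b'
  proof -
    have "b = b'"
      using uniq[of a b b'] T(5)[OF that(1)] T(5)[OF that(2)] T(2)[OF that(1)] T(1)[OF that(2)]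
      by (simp add: add.commute)
    then have "b = a" using T(3)[OF that(1)] T(3)[OF that(2)] by simp
    then show ?thesis using T(5)[OF that(1)] union that(1) by (force simp: halves_def)
  qed
  then have inter: "fst ` ?T \<inter> snd ` ?T \<subseteq> halves c" by fastforce
  have fin: "finite ?T" by simp
  have "inj_on fst ?T"
  proof (rule inj_onI)
    fix t u assume *: "t \<in> ?T" "u \<in> ?T" "fst t = fst u"
    obtain a b b' where tu: "t = (a, b)" "u = (a, b')" using *(3) by (cases t; cases u) auto
    then show "t = u"
      using uniq[of a b b'] T(2,5)[of a b] T(2,5)[of a b'] *(1,2) by blast
  qed
  moreover have "inj_on snd ?T"
  proof (rule inj_onI)
    fix t u assume *: "t \<in> ?T" "u \<in> ?T" "snd t = snd u"
    obtain a a' b where tu: "t = (a, b)" "u = (a', b)" using *(3) by (cases t; cases u) auto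
    then show "t = u"
      using uniq[of b a a'] T(1,5)[of a b] T(1,5)[of a' b] *(1,2) by (simp only: add.commute)
  qed
  ultimately have "2 * card ?T = card (fst ` ?T) + card (snd ` ?T)" by (simp add: card_image)
  also have "\<dots> = card (fst ` ?T \<union> snd ` ?T) + card (fst ` ?T \<inter> snd ` ?T)"
    by (rule card_Un_Int) (use fin in auto)
  also have "\<dots> \<le> card (summands c) + card (halves c)"
    using union inter by (intro add_mono card_mono) auto
  finally show ?thesis .
qed

lemma decomposables_range: "decomposables \<subseteq> {1..<m}"
proof -
  have "(a + b) mod m \<in> {1..<m}" if "(a, b) \<in> tight_pairs" for a b
  proof (rule mod_in_range, rule notI)
    assume "m dvd a + b"
    then have "X (a + b) = 0" using cong[of "a + b" 0] zero by simp
    then show False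
      using that pos[of a] pos[of b] not_dvd_range by (auto simp: tight_pairs_def)
  qed
  then show ?thesis by (auto simp: decomposables_def)
qed

lemma card_tight_pairs_le:
  "2 * card tight_pairs \<le> (\<Sum>c\<in>decomposables. card (summands c) + card (halves c))"
proof -
  have "tight_pairs = (\<Union>c\<in>decomposables. {t \<in> tight_pairs. (fst t + snd t) mod m = c})"
    by (force simp: decomposables_def)
  then have "card tight_pairs \<le> (\<Sum>c\<in>decomposables. card {t \<in> tight_pairs. (fst t + snd t) mod m = c})"
    using card_UN_le[of decomposables "\<lambda>c. {t \<in> tight_pairs. (fst t + snd t) mod m = c}"]
    by (simp add: decomposables_def)
  then have "2 * card tight_pairs \<le> (\<Sum>c\<in>decomposables. 2 * card {t \<in> tight_pairs. (fst t + snd t) mod m = c})"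
    by (simp flip: sum_distrib_left)
  also have "\<dots> \<le> (\<Sum>c\<in>decomposables. card (summands c) + card (halves c))"
    using decomposables_range by (intro sum_mono card_fibre_le) auto
  finally show ?thesis .
qed

lemma tie_decomposable:
  assumes "\<not> m dvd a" "\<not> m dvd b" "X a + X b = X (a + b)"
  shows "(a + b) mod m \<in> decomposables"
proof -
  have *: "(c + d) mod m \<in> decomposables" if "\<not> m dvd c" "\<not> m dvd d" "X c + X d = X (c + d)" "c mod m \<le> d mod m" for c d
  proof -
    have "X (c mod m + d mod m) = X (c + d)"
      using X_mod[of "c mod m + d mod m"] X_mod[of "c + d"] by (simp add: mod_simps)
    then have "(c mod m, d mod m) \<in> tight_pairs"
      using that mod_in_range by (auto simp: tight_pairs_def X_mod)
    then show ?thesis unfolding decomposables_def by (force simp: mod_simps)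
  qed
  show ?thesis using *[of a b] *[of b a] assms by (cases "a mod m \<le> b mod m") (simp_all add: add.commute)
qed

lemma distinct_halves_distance:
  assumes "a \<in> {1..<m}" "b \<in> {1..<m}" "a \<noteq> b" "m dvd 2 * a - c" "m dvd 2 * b - c"
  shows "m = 2 * \<bar>a - b\<bar>"
proof -
  have "m dvd 2 * (a - b)" using dvd_diff[OF assms(4,5)] by (simp add: algebra_simps)
  then obtain k where k: "2 * (a - b) = m * k" by blast
  have "\<bar>2 * (a - b)\<bar> < m * 2" using assms(1,2) by auto
  then have "\<bar>m * k\<bar> < m * 2" by (simp only: k)
  then have "\<bar>k\<bar> < 2" using m_ge by (simp add: abs_mult)
  moreover have "k \<noteq> 0" using k assms(3) by auto
  ultimately have "k = 1 \<or> k = -1" by auto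
  then show ?thesis using k m_ge by auto
qed

text \<open>
  Every half \<open>a\<close> of \<open>c\<close> has \<open>2 X a = X c\<close>, so \<open>X\<close> identifies the halves of \<open>c\<close>; and two
  distinct solutions of \<open>2 a = c\<close> are \<open>m / 2\<close> apart.
\<close>

lemma card_halves_ge_2:
  assumes "card (halves c) \<ge> 2"
  shows "even m \<and> \<not> inj_on X {1..<m}"
proof -
  obtain a b where ab: "a \<in> halves c" "b \<in> halves c" "a \<noteq> b"
    using assms card_le_Suc0_iff_eq[of "halves c"] by fastforce
  have X: "X c = 2 * X a" if "a \<in> halves c" for a
  proof -
    have "X (c - a) = X a"
      using that by (intro cong) (auto simp: halves_def dvd_diff_commute algebra_simps)
    then show ?thesis using that by (simp add: halves_def summands_def)
  qed
  have "X a = X b" using X[OF ab(1)] X[OF ab(2)] by simp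
  moreover have "a \<in> {1..<m}" "b \<in> {1..<m}" using ab by (auto simp: halves_def summands_def)
  moreover have "m = 2 * \<bar>a - b\<bar>"
    using calculation ab by (intro distinct_halves_distance[of a b c]) (auto simp: halves_def)
  ultimately show ?thesis using ab(3) by (metis inj_onD dvd_triv_left)
qed

lemma tie_if_not_defect:
  assumes "a mod m \<notin> defects c" "c \<in> {1..<m}"
  shows "X a + X (c - a) = X c"
proof -
  consider "m dvd a" | "m dvd a - c" | "a mod m \<in> {1..<m}" "a mod m \<noteq> c"
    using mod_in_range[of a] assms(2) by (metis mod_eq_dvd_iff mod_mod_trivial)
  then show ?thesis
  proof cases
    case 1
    then have "X a = X 0" "X (c - a) = X c" by (auto intro!: cong)
    then show ?thesis by (simp add: zero)
  next
    case 2
    then have "X a = X c" "X (c - a) = X 0" by (auto intro!: cong simp: dvd_diff_commute)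
    then show ?thesis by (simp add: zero)
  next
    case 3
    have "X (c - a mod m) = X (c - a)"
      using X_mod[of "c - a mod m"] X_mod[of "c - a"] by (simp add: mod_simps)
    then show ?thesis using 3 assms(1) by (simp add: defects_def X_mod)
  qed
qed

lemma defects_reflect:
  assumes "a \<in> defects c" "c \<in> {1..<m}"
  shows "(c - a) mod m \<in> defects c"
  using tie_if_not_defect[of "c - a" c] assms by (auto simp: defects_def)

text \<open>
  Because \<open>X q \<le> X p\<close>, both \<open>p\<close> and \<open>q - p\<close> are defects of \<open>q\<close>.  By injectivity or odd \<open>m\<close> each of \<open>p\<close>
  and \<open>q\<close> has at most one half, so there are at most two defects.  If these are all, the case is settled
  by a translation argument.  A further defect \<open>r\<close> can exist only if \<open>p = q - p\<close>, and \<open>r\<close> is then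
  its own reflection, since defects of \<open>c\<close> are stable under \<open>a \<mapsto> c - a\<close>.  If \<open>r\<close> belongs to \<open>q\<close>, the
  equation \<open>2 a = q\<close> has the three solutions \<open>p\<close>, \<open>r\<close> and a half of \<open>q\<close>, which is too many.  If \<open>r\<close>
  belongs to \<open>p\<close>, then \<open>p = 2 r\<close> and \<open>q = 4 r\<close>, and \<open>p\<close> has a half besides \<open>r\<close>, so that \<open>m\<close> is even
  and \<open>X\<close> injective; this is the other translation argument.
\<close>

lemma two_decomposables_few_defects_impossible:
  assumes pq: "p \<in> {1..<m}" "q \<in> {1..<m}" "p \<noteq> q" "decomposables \<subseteq> {p, q}" and ge: "X q \<le> X p"
    and few: "card (defects p) + card (defects q) \<le> card (halves p) + card (halves q)"
    and inj: "even m \<Longrightarrow> inj_on X {1..<m}"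
  shows False
proof -
  have nonatom: "m dvd a + b - p \<or> m dvd a + b - q"
    if "\<not> m dvd a" "\<not> m dvd b" "X a + X b = X (a + b)" for a b
    using tie_decomposable[OF that] pq by (auto simp flip: mod_eq_dvd_iff)
  have half: "card (halves c) \<le> 1" for c
    using card_halves_ge_2[of c] inj by fastforce
  have le2: "card (defects p) + card (defects q) \<le> 2"
    using few half[of p] half[of q] by simp
  define s where "s = (q - p) mod m"
  have pD: "p \<in> defects q"
    using pq ge pos[of "q - p"] not_dvd_diff[of q p] by (auto simp: defects_def)
  then have sD: "s \<in> defects q" using defects_reflect pq by (simp add: s_def)
  consider "defects p = {}" "defects q \<subseteq> {p, s}"
    | r where "r \<in> defects p" | r where "r \<in> defects q" "r \<noteq> p" "r \<noteq> s" by blast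
  then show False
  proof cases
    case 1
    show False
    proof (rule all_but_one_tight_impossible[of p q])
      show "\<not> m dvd p" "\<not> m dvd q" "\<not> m dvd p - q"
        using pq not_dvd_range not_dvd_diff by auto
      show "X a + X (p - a) = X p" for a using 1 pq by (intro tie_if_not_defect) auto
      show "X a + X (q - a) = X q" if "\<not> m dvd a - p" "\<not> m dvd a - (q - p)" for a
      proof (rule tie_if_not_defect)
        have "a mod m \<noteq> p" "a mod m \<noteq> s"
          using that pq by (auto simp: s_def simp flip: mod_eq_dvd_iff)
        then show "a mod m \<notin> defects q" using 1 by auto
      qed (use pq in auto)
    qed (use ge nonatom in auto)
  next
    case 2
    have cp: "1 \<le> card (defects p)" using 2 by (metis One_nat_def Suc_leI card_gt_0_iff empty_iff finite_defects)
    have "card {p} \<le> card (defects q)" using pD by (intro card_mono) auto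
    then have cards: "card (defects p) = 1" "card (defects q) = 1" using cp le2 by auto
    have Dp: "defects p = {r}" using cards(1) 2 by (metis card_1_singletonE singletonD)
    have Dq: "defects q = {p}" using cards(2) pD by (metis card_1_singletonE singletonD)
    have rR: "r \<in> {1..<m}" using 2 by (simp add: defects_def)
    have "(p - r) mod m = r" using defects_reflect[OF 2 pq(1)] Dp by simp
    then have p2r: "m dvd p - 2 * r"
      using rR by (metis mod_eq_dvd_iff mod_mod_trivial diff_diff_eq mult_2)
    have "(q - p) mod m = p" using sD Dq by (simp add: s_def)
    then have q2p: "m dvd q - 2 * p"
      by (metis mod_eq_dvd_iff mod_mod_trivial diff_diff_eq mult_2)
    have "m dvd (q - 2 * p) + 2 * (p - 2 * r)" using p2r q2p by (intro dvd_add dvd_mult)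
    then have q4r: "m dvd q - 4 * r" by (simp add: algebra_simps)
    have "card (halves p) = 1" using few cards half[of p] half[of q] by simp
    then obtain h where h: "h \<in> halves p" by (metis card_1_singletonE singletonI)
    have "h \<noteq> r" using h 2 by (auto simp: halves_def summands_def defects_def)
    then have "m = 2 * \<bar>h - r\<bar>"
      using h rR p2r by (intro distinct_halves_distance[of h r p]) (auto simp: halves_def summands_def dvd_diff_commute)
    then have "even m" by (metis dvd_triv_left)
    then have "X p \<noteq> X q" using inj pq by (auto dest: inj_onD)
    have X: "X p = X (2 * r)" "X q = X (4 * r)" using p2r q4r by (auto intro: cong)
    then have "X (2 * r) \<noteq> X (4 * r)" using \<open>X p \<noteq> X q\<close> by simp
    have pc: "m dvd c - p \<longleftrightarrow> m dvd c - 2 * r" and qc: "m dvd c - q \<longleftrightarrow> m dvd c - 4 * r" for c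
      using dvd_add_left_iff[OF p2r, of "c - p"] dvd_add_left_iff[OF q4r, of "c - q"] by simp_all
    show False
    proof (rule two_loops_missing_impossible[of r])
      show "X (2 * r) \<noteq> X (4 * r)" by fact
      show "X a + X (2 * r - a) = X (2 * r)" if "\<not> m dvd a - r" for a
      proof -
        have "a mod m \<noteq> r" using that rR by (auto simp flip: mod_eq_dvd_iff)
        then have "X a + X (p - a) = X p" using Dp pq by (intro tie_if_not_defect) auto
        moreover have "X (p - a) = X (2 * r - a)" using p2r by (intro cong) simp
        ultimately show ?thesis using X by simp
      qed
      show "X a + X (4 * r - a) = X (4 * r)" if "\<not> m dvd a - 2 * r" for a
      proof -
        have "a mod m \<noteq> p" using that pc[of a] by auto
        then have "X a + X (q - a) = X q" using Dq pq by (intro tie_if_not_defect) auto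
        moreover have "X (q - a) = X (4 * r - a)" using q4r by (intro cong) simp
        ultimately show ?thesis using X by simp
      qed
      show "m dvd a + b - 2 * r \<or> m dvd a + b - 4 * r"
        if "\<not> m dvd a" "\<not> m dvd b" "X a + X b = X (a + b)" for a b
        using nonatom[OF that] pc qc by blast
    qed
  next
    case (3 r)
    have "s = p"
    proof (rule ccontr)
      assume "s \<noteq> p"
      then have "card {p, s, r} = 3" using 3 by auto
      moreover have "card {p, s, r} \<le> card (defects q)" using pD sD 3 by (intro card_mono) auto
      ultimately show False using le2 by simp
    qed
    then have q2p: "m dvd q - 2 * p"
      unfolding s_def by (metis mod_eq_dvd_iff mod_mod_trivial diff_diff_eq mult_2)
    have c2: "card {p, r} = 2" using 3 by auto
    have sub: "{p, r} \<subseteq> defects q" using pD 3 by auto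
    then have "2 \<le> card (defects q)" using c2 card_mono[OF finite_defects sub] by simp
    then have Dq: "defects q = {p, r}" and "card (halves q) = 1"
      using le2 c2 few half[of p] half[of q] card_seteq[OF finite_defects sub] by auto
    then obtain h where h: "h \<in> halves q" by (metis card_1_singletonE singletonI)
    have rR: "r \<in> {1..<m}" using 3 by (simp add: defects_def)
    have "(q - r) mod m \<noteq> p"
    proof
      assume "(q - r) mod m = p"
      then have "m dvd q - r - p" using pq(1) by (metis mod_eq_dvd_iff mod_mod_trivial)
      then have "m dvd (q - r - p) - (q - 2 * p)" using q2p by (rule dvd_diff)
      then have "m dvd p - r" by simp
      then show False using not_dvd_diff[OF pq(1) rR] 3 by simp
    qed
    then have "(q - r) mod m = r" using defects_reflect[OF 3(1) pq(2)] Dq by auto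
    then have q2r: "m dvd q - 2 * r"
      by (metis mod_eq_dvd_iff mod_mod_trivial diff_diff_eq mult_2)
    have hR: "h \<in> {1..<m}" "m dvd 2 * h - q" using h by (auto simp: halves_def summands_def)
    have "h \<notin> defects q" using h by (auto simp: halves_def summands_def defects_def)
    then have "h \<noteq> p" "h \<noteq> r" using Dq by auto
    then have "m = 2 * \<bar>h - p\<bar>" "m = 2 * \<bar>h - r\<bar>" "m = 2 * \<bar>p - r\<bar>"
      using 3 hR rR pq q2p q2r by (auto intro!: distinct_halves_distance[of _ _ q] simp: dvd_diff_commute)
    then show False using m_ge by (auto simp: abs_if split: if_splits)
  qed
qed

text \<open>
  Each of the two decomposable residues has \<open>m - 2\<close> minus its number of defects as summands; comparing
  with the number of ties bounds the defects by the halves.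
\<close>

lemma two_decomposables_many_ties_impossible:
  assumes "card decomposables = 2" "m - 2 \<le> int (card tight_pairs)"
    and inj: "even m \<Longrightarrow> inj_on X {1..<m}"
  shows False
proof -
  obtain p q where pq: "decomposables = {p, q}" "p \<noteq> q" using assms(1) by (auto simp: card_2_iff)
  then have R: "p \<in> {1..<m}" "q \<in> {1..<m}" using decomposables_range by auto
  have "2 * card tight_pairs \<le> card (summands p) + card (halves p) + (card (summands q) + card (halves q))"
    using card_tight_pairs_le pq by simp
  then have few: "card (defects p) + card (defects q) \<le> card (halves p) + card (halves q)"
    using card_summands_defects[OF R(1)] card_summands_defects[OF R(2)] assms(2) by linarith
  show False
  proof (cases "X q \<le> X p")
    case True
    then show ?thesis
      using two_decomposables_few_defects_impossible[of p q] R pq few inj by blast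
  next
    case False
    then show ?thesis
      using two_decomposables_few_defects_impossible[of q p] R pq few inj by (simp add: insert_commute add.commute)
  qed
qed

text \<open>
  A single residue has at most \<open>m - 2\<close> summands, so that at least two halves are needed to reach \<open>m / 2\<close>
  ties.
\<close>

lemma one_decomposable_many_ties:
  assumes "card decomposables = 1" "m \<le> 2 * int (card tight_pairs)"
  shows "even m \<and> \<not> inj_on X {1..<m}"
proof -
  obtain p where p: "decomposables = {p}" using assms(1) by (rule card_1_singletonE)
  then have "p \<in> {1..<m}" using decomposables_range by auto
  then have "card (halves p) \<ge> 2"
    using card_tight_pairs_le card_summands_defects[of p] assms(2) p by simp
  then show ?thesis by (rule card_halves_ge_2)
qed

end

section \<open>Ties on faces of the Kunz cone\<close>

definition coord_space :: "nat \<Rightarrow> (nat \<Rightarrow> real) set" where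
  "coord_space m = {x. \<forall>i. i \<notin> {1..<m} \<longrightarrow> x i = 0}"

definition slack :: "nat \<Rightarrow> nat \<Rightarrow> nat \<Rightarrow> (nat \<Rightarrow> real) \<Rightarrow> real" where
  "slack m i j x = x i + x j - x ((i + j) mod m)"

definition kunz_constraints :: "nat \<Rightarrow> ((nat \<Rightarrow> real) \<Rightarrow> real) set" where
  "kunz_constraints m = (\<lambda>i x. x i) ` {1..<m} \<union>
    (\<lambda>(i, j). slack m i j) ` {(i, j) \<in> {1..<m} \<times> {1..<m}. (i + j) mod m \<noteq> 0}"

lemma linear_slack: "linear (slack m i j)"
  by (rule linearI) (simp_all add: slack_def algebra_simps)

lemma linear_apply: "linear (\<lambda>x :: nat \<Rightarrow> real. x i)"
  by (rule linearI) simp_all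

lemma polyhedral_kunz: "polyhedral_cone (coord_space m) (kunz_constraints m)"
proof (rule polyhedral_cone.intro)
  show "subspace (coord_space m)"
    by (auto simp: real_vector.subspace_def coord_space_def)
  have "kunz_constraints m \<subseteq> (\<lambda>i x. x i) ` {1..<m} \<union> (\<lambda>(i, j). slack m i j) ` ({1..<m} \<times> {1..<m})"
    by (auto simp: kunz_constraints_def)
  then show "finite (kunz_constraints m)" by (rule finite_subset) simp
  show "linear \<phi>" if "\<phi> \<in> kunz_constraints m" for \<phi>
    using that by (auto simp: kunz_constraints_def linear_slack linear_apply)
qed

interpretation kunz: polyhedral_cone "coord_space m" "kunz_constraints m" for m
  by (rule polyhedral_kunz)

lemma kunz_cone_eq: "kunz_cone m = kunz.cone m"
proof -
  have "x \<in> kunz_cone m \<longleftrightarrow> x \<in> coord_space m \<and> (\<forall>\<phi>\<in>kunz_constraints m. 0 \<le> \<phi> x)" for x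
  proof -
    have "(\<forall>\<phi>\<in>kunz_constraints m. 0 \<le> \<phi> x) \<longleftrightarrow> (\<forall>i\<in>{1..<m}. 0 \<le> x i) \<and>
        (\<forall>i\<in>{1..<m}. \<forall>j\<in>{1..<m}. (i + j) mod m \<noteq> 0 \<longrightarrow> 0 \<le> slack m i j x)"
      unfolding kunz_constraints_def by (auto simp: ball_Un)
    then show ?thesis unfolding kunz_cone_def coord_space_def slack_def mem_Collect_eq by simp
  qed
  then show ?thesis unfolding kunz.cone_def by blast
qed

lemma kunz_tight_iff: "\<phi> \<in> kunz.tight m x \<longleftrightarrow> \<phi> \<in> kunz_constraints m \<and> \<phi> x = 0"
  by (simp add: kunz.tight_def)

lemma face_interior_eq: "face_interior m F = kunz.relint m F"
  by (auto simp: face_interior_def kunz.relint_def kunz_face_def kunz_cone_eq)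

lemma coordinate_basis:
  obtains E where "finite E" "independent E" "span E = coord_space m" "card E = m - 1"
proof -
  define u where "u i = (\<lambda>j. if j = i then 1 else 0 :: real)" for i :: nat
  have "inj u" by (rule injI) (metis u_def zero_neq_one)
  have expand: "(\<Sum>i\<in>{1..<m}. c i *\<^sub>R u i) = (\<lambda>j. if j \<in> {1..<m} then c j else 0)" for c :: "nat \<Rightarrow> real"
  proof
    fix j
    have "(\<Sum>i\<in>A. c i *\<^sub>R u i) j = (if j \<in> A then c j else 0)" if "finite A" for A
      using that by (induction A rule: finite_induct) (auto simp: u_def)
    then show "(\<Sum>i\<in>{1..<m}. c i *\<^sub>R u i) j = (if j \<in> {1..<m} then c j else 0)" by simp
  qed
  have "independent (u ` {1..<m})"
  proof (rule real_vector.independent_if_scalars_zero)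
    show "finite (u ` {1..<m})" by simp
  next
    fix c v assume *: "(\<Sum>x\<in>u ` {1..<m}. c x *\<^sub>R x) = 0" "v \<in> u ` {1..<m}"
    then obtain j where j: "v = u j" "j \<in> {1..<m}" by blast
    have "(\<Sum>i\<in>{1..<m}. c (u i) *\<^sub>R u i) = 0"
      using *(1) \<open>inj u\<close> by (simp add: sum.reindex inj_on_subset[of u UNIV])
    then have "(if j \<in> {1..<m} then c (u j) else 0) = (0 :: nat \<Rightarrow> real) j"
      unfolding expand by (rule fun_cong)
    then show "c v = 0" using j by simp
  qed
  moreover have "span (u ` {1..<m}) = coord_space m"
  proof
    have "subspace (coord_space m)" by (rule kunz.subspace_V)
    then show "span (u ` {1..<m}) \<subseteq> coord_space m"
      by (intro real_vector.span_minimal) (auto simp: coord_space_def u_def)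
  next
    show "coord_space m \<subseteq> span (u ` {1..<m})"
    proof
      fix x assume "x \<in> coord_space m"
      then have "x = (\<Sum>i\<in>{1..<m}. x i *\<^sub>R u i)"
        unfolding expand by (auto simp: coord_space_def)
      also have "\<dots> \<in> span (u ` {1..<m})"
        by (intro real_vector.span_sum real_vector.span_scale real_vector.span_base) auto
      finally show "x \<in> span (u ` {1..<m})" .
    qed
  qed
  moreover have "card (u ` {1..<m}) = m - 1"
    using \<open>inj u\<close> by (simp add: card_image inj_on_subset[of u UNIV])
  ultimately show ?thesis using that[of "u ` {1..<m}"] by simp
qed

definition periodic_extension :: "nat \<Rightarrow> (nat \<Rightarrow> real) \<Rightarrow> int \<Rightarrow> real" where
  "periodic_extension m x a = x (nat (a mod int m))"

lemma periodic_extension_of_nat [simp]: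
  "i < m \<Longrightarrow> periodic_extension m x (int i) = x i"
  by (simp add: periodic_extension_def)

lemma periodic_extension_add [simp]:
  "periodic_extension m x (int i + int j) = x ((i + j) mod m)"
  by (simp add: periodic_extension_def nat_mod_as_int)

lemma residue_weight_periodic_extension:
  assumes "m \<ge> 7" "x 0 = 0" "\<And>i. i \<in> {1..<m} \<Longrightarrow> x i > 0"
  shows "residue_weight (int m) (periodic_extension m x)"
proof
  show "7 \<le> int m" using assms by simp
  show "periodic_extension m x a = periodic_extension m x b" if "int m dvd a - b" for a b
    using that unfolding periodic_extension_def by (simp flip: mod_eq_dvd_iff)
  show "periodic_extension m x 0 = 0" using assms by (simp add: periodic_extension_def)
  show "0 < periodic_extension m x a" if "\<not> int m dvd a" for a
  proof -
    have "0 \<le> a mod int m" "a mod int m < int m" "a mod int m \<noteq> 0"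
      using assms(1) that by (simp_all add: dvd_eq_mod_eq_0)
    then show ?thesis unfolding periodic_extension_def by (intro assms) auto
  qed
qed

lemma face_interior_coords:
  assumes "kunz_face m F" "\<not> degenerate_face m F" "x \<in> face_interior m F"
  shows "x i > 0 \<longleftrightarrow> i \<in> {1..<m}" "i \<notin> {1..<m} \<Longrightarrow> x i = 0"
proof -
  have K: "x \<in> kunz_cone m"
    using assms by (auto simp: kunz_face_def face_of_def face_interior_def)
  then show *: "x i = 0" if "i \<notin> {1..<m}"
    using that by (simp add: kunz_cone_def)
  have "x i \<ge> 0" "x i \<noteq> 0" if "i \<in> {1..<m}"
    using K assms that unfolding kunz_cone_def degenerate_face_def by blast+
  then show "x i > 0 \<longleftrightarrow> i \<in> {1..<m}" using * by fastforce
qed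

text \<open>
  Interior points of a face have the same tight constraints.  The sums \<open>i + j = 0\<close>, which give no
  constraint of the cone, are never ties because the coordinates are positive.
\<close>

lemma face_interior_same_ties:
  assumes face: "kunz_face m F" "\<not> degenerate_face m F"
    and xy: "x \<in> face_interior m F" "y \<in> face_interior m F"
    and ij: "i \<in> {1..<m}" "j \<in> {1..<m}"
  shows "x i + x j = x ((i + j) mod m) \<longleftrightarrow> y i + y j = y ((i + j) mod m)"
proof (cases "(i + j) mod m = 0")
  case True
  have "x i > 0" "x j > 0" "x 0 = 0" "y i > 0" "y j > 0" "y 0 = 0"
    using face_interior_coords[OF face xy(1)] face_interior_coords[OF face xy(2)] ij by auto
  then show ?thesis using True by simp
next
  case False
  have F: "F face_of kunz.cone m" using face by (simp add: kunz_face_def kunz_cone_eq)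
  have "x \<in> kunz.relint m F" "y \<in> kunz.relint m F" "x \<in> F" "y \<in> F"
    using xy by (auto simp: face_interior_def simp flip: face_interior_eq)
  then have "kunz.tight m x = kunz.tight m y"
    using kunz.tight_relint_subset[OF F] by blast
  moreover have "slack m i j \<in> kunz_constraints m" using False ij by (auto simp: kunz_constraints_def)
  ultimately have "slack m i j x = 0 \<longleftrightarrow> slack m i j y = 0" using kunz_tight_iff by metis
  then show ?thesis by (simp add: slack_def)
qed

context
  fixes m :: nat and F :: "(nat \<Rightarrow> real) set" and x
  assumes m: "m \<ge> 7" and face: "kunz_face m F" and nondeg: "\<not> degenerate_face m F"
    and x: "x \<in> face_interior m F"
begin

lemmas x_coords = face_interior_coords[OF face nondeg x]

interpretation residue_weight "int m" "periodic_extension m x"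
  using m x_coords by (intro residue_weight_periodic_extension) auto

text \<open>
  No coordinate of \<open>x\<close> vanishes, so the constraints tight at \<open>x\<close> are the triangle inequalities given
  by ties; the order of the two summands does not matter.
\<close>

lemma dim_plus_ties_ge: "m - 1 \<le> dim F + card tight_pairs"
proof -
  define T where "T = (\<lambda>(a, b). slack m (nat a) (nat b)) ` tight_pairs"
  have "kunz.tight m x \<subseteq> T"
  proof
    fix \<phi> assume "\<phi> \<in> kunz.tight m x"
    then have \<phi>: "\<phi> \<in> kunz_constraints m" "\<phi> x = 0" by (simp_all add: kunz_tight_iff)
    have "\<phi> \<notin> (\<lambda>i x. x i) ` {1..<m}"
    proof
      assume "\<phi> \<in> (\<lambda>i x. x i) ` {1..<m}"
      then obtain i where "i \<in> {1..<m}" "\<phi> = (\<lambda>x. x i)" by (elim imageE)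
      then show False using \<phi>(2) x_coords(1)[of i] by simp
    qed
    then have "\<phi> \<in> (\<lambda>(i, j). slack m i j) ` ({1..<m} \<times> {1..<m})"
      using \<phi>(1) unfolding kunz_constraints_def by blast
    with \<phi>(2) obtain i j where ij: "\<phi> = slack m i j" "i \<in> {1..<m}" "j \<in> {1..<m}" "slack m i j x = 0"
      by auto
    have *: "slack m k l \<in> T" if "k \<in> {1..<m}" "l \<in> {1..<m}" "slack m k l x = 0" "k \<le> l" for k l
    proof -
      have "(int k, int l) \<in> tight_pairs"
        using that by (auto simp: tight_pairs_def slack_def)
      then show ?thesis unfolding T_def by force
    qed
    have "slack m i j = slack m j i" by (auto simp: slack_def add.commute)
    then show "\<phi> \<in> T" using *[of i j] *[of j i] ij by (cases "i \<le> j") auto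
  qed
  then have "card (kunz.tight m x) \<le> card tight_pairs"
    by (rule surj_card_le[OF finite_tight_pairs, of _ "\<lambda>(a, b). slack m (nat a) (nat b)", folded T_def])
  moreover obtain E where E: "finite E" "independent E" "span E = coord_space m" "card E = m - 1"
    using coordinate_basis by blast
  moreover have "card E \<le> dim F + card (kunz.tight m x)"
    using face x E(1-3)
    by (intro kunz.dim_face_ge) (auto simp: kunz_face_def kunz_cone_eq face_interior_def)
  ultimately show ?thesis by simp
qed

lemma tight_pairs_iff:
  "(a, b) \<in> tight_pairs \<longleftrightarrow> (\<exists>i\<in>{1..<m}. \<exists>j\<in>{1..<m}. a = int i \<and> b = int j \<and> i \<le> j \<and> x i + x j = x ((i + j) mod m))"
proof
  assume *: "(a, b) \<in> tight_pairs"
  then obtain i j where "a = int i" "b = int j"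
    using zero_le_imp_eq_int[of a] zero_le_imp_eq_int[of b] by (auto simp: tight_pairs_def)
  then show "\<exists>i\<in>{1..<m}. \<exists>j\<in>{1..<m}. a = int i \<and> b = int j \<and> i \<le> j \<and> x i + x j = x ((i + j) mod m)"
    using * by (auto simp: tight_pairs_def)
qed (auto simp: tight_pairs_def)

lemma decomposables_eq:
  "decomposables = int ` {c. \<exists>i\<in>{1..<m}. \<exists>j\<in>{1..<m}. c = (i + j) mod m \<and> x i + x j = x c}"
proof (intro equalityI subsetI)
  fix c assume "c \<in> decomposables"
  then obtain a b where "(a, b) \<in> tight_pairs" "c = (a + b) mod int m"
    by (auto simp: decomposables_def)
  then obtain i j where ij: "i \<in> {1..<m}" "j \<in> {1..<m}" "c = (int i + int j) mod int m"
    "x i + x j = x ((i + j) mod m)" unfolding tight_pairs_iff by blast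
  have "c = int ((i + j) mod m)" using ij(3) by (simp add: of_nat_mod)
  then show "c \<in> int ` {c. \<exists>i\<in>{1..<m}. \<exists>j\<in>{1..<m}. c = (i + j) mod m \<and> x i + x j = x c}"
    using ij by blast
next
  fix c assume "c \<in> int ` {c. \<exists>i\<in>{1..<m}. \<exists>j\<in>{1..<m}. c = (i + j) mod m \<and> x i + x j = x c}"
  then obtain i j where ij: "i \<in> {1..<m}" "j \<in> {1..<m}" "c = int ((i + j) mod m)"
    "x i + x j = x ((i + j) mod m)" by blast
  have "(int i + int j) mod int m \<in> decomposables"
    using ij m not_dvd_range[of "int i"] not_dvd_range[of "int j"] by (intro tie_decomposable) auto
  then show "c \<in> decomposables" using ij(3) by (simp add: of_nat_mod)
qed

text \<open>
  The atoms are the nonzero residues that are not decomposable.  The nil element is no atom, as it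
  is the product of itself with itself.
\<close>

lemma card_decomposables: "card decomposables + embedding_dim m F = m - 1"
proof -
  define y where "y = (SOME x. x \<in> face_interior m F)"
  have y: "y \<in> face_interior m F" unfolding y_def using x by (rule someI[of "\<lambda>x. x \<in> face_interior m F"])
  define D where "D = {c. \<exists>i\<in>{1..<m}. \<exists>j\<in>{1..<m}. c = (i + j) mod m \<and> x i + x j = x c}"
  have y0: "y i + y j = y ((i + j) mod m) \<longleftrightarrow> x i + x j = x ((i + j) mod m)"
    if "i \<in> {1..<m}" "j \<in> {1..<m}" for i j
    using face_interior_same_ties[OF face nondeg y x that] .
  have car: "carrier (kunz_nilsemigroup m F) - {\<one>\<^bsub>kunz_nilsemigroup m F\<^esub>} = insert None (Some ` {1..<m})"
    using m by (auto simp: kunz_nilsemigroup_def Let_def)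
  have mult: "Some i \<otimes>\<^bsub>kunz_nilsemigroup m F\<^esub> Some j =
      (if y i + y j = y ((i + j) mod m) then Some ((i + j) mod m) else None)"
    "None \<otimes>\<^bsub>kunz_nilsemigroup m F\<^esub> u = None" "u \<otimes>\<^bsub>kunz_nilsemigroup m F\<^esub> None = None" for i j u
    by (simp_all add: kunz_nilsemigroup_def Let_def y_def split: option.split)
  have "a \<in> atoms (kunz_nilsemigroup m F) \<longleftrightarrow> a \<in> Some ` ({1..<m} - D)" for a
  proof (cases a)
    case None
    then show ?thesis unfolding atoms_def car by (auto simp: mult)
  next
    case (Some c)
    have "(\<exists>u\<in>insert None (Some ` {1..<m}). \<exists>v\<in>insert None (Some ` {1..<m}).
        Some c = u \<otimes>\<^bsub>kunz_nilsemigroup m F\<^esub> v) \<longleftrightarrow> c \<in> D"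
      using y0 unfolding D_def by (auto simp: mult split: if_splits)
    then show ?thesis unfolding atoms_def car Some by auto
  qed
  then have "atoms (kunz_nilsemigroup m F) = Some ` ({1..<m} - D)" by blast
  then have "embedding_dim m F = card ({1..<m} - D)" by (simp add: embedding_dim_def card_image)
  moreover have "D \<subseteq> {1..<m}"
    using decomposables_range unfolding decomposables_eq D_def[symmetric] by auto
  moreover have "card decomposables = card D"
    unfolding decomposables_eq D_def[symmetric] by (simp add: card_image)
  ultimately show ?thesis
    using card_Diff_subset[of D "{1..<m}"] card_mono[of "{1..<m}" D] finite_subset[of D "{1..<m}"] by auto
qed

text \<open>
  The residue modulo \<open>m\<close> of a coordinate of an Apery point recovers the index of this coordinate.
\<close>

lemma apery_imp_inj:
  assumes "apery_point m x"
  shows "inj_on (periodic_extension m x) {1..<int m}"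
proof (rule inj_onI)
  fix a b assume ab: "a \<in> {1..<int m}" "b \<in> {1..<int m}" "periodic_extension m x a = periodic_extension m x b"
  obtain i j where ij: "a = int i" "b = int j"
    using ab zero_le_imp_eq_int[of a] zero_le_imp_eq_int[of b] by auto
  have R: "i \<in> {1..<m}" "j \<in> {1..<m}" and eq: "x i = x j" using ab by (auto simp: ij)
  then obtain k l where "x i = of_int k" "k mod int m = int i mod int m" "x j = of_int l" "l mod int m = int j mod int m"
    using assms unfolding apery_point_def by metis
  then have "int i mod int m = int j mod int m" using eq by simp
  then show "a = b" using R by (simp add: ij)
qed

lemma even_and_noninj:
  assumes "(real (dim F) = real m / 2 - 1 \<and> embedding_dim m F = m - 2) \<or> (dim F = 1 \<and> embedding_dim m F = m - 3)"
  shows "even m \<and> \<not> inj_on (periodic_extension m x) {1..<int m}"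
  using assms
proof
  assume *: "real (dim F) = real m / 2 - 1 \<and> embedding_dim m F = m - 2"
  then have "m = 2 * dim F + 2" by linarith
  then have "int m \<le> 2 * int (card tight_pairs)" using dim_plus_ties_ge by linarith
  moreover have "card decomposables = 1" using * card_decomposables m by simp
  ultimately show ?thesis using one_decomposable_many_ties by simp
next
  assume *: "dim F = 1 \<and> embedding_dim m F = m - 3"
  then have "int m - 2 \<le> int (card tight_pairs)" using dim_plus_ties_ge m by linarith
  moreover have "card decomposables = 2" using * card_decomposables m by simp
  ultimately show ?thesis using two_decomposables_many_ties_impossible by auto
qed

end

theorem proposition4p5:
  fixes m d e :: nat and F :: "(nat \<Rightarrow> real) set"
  assumes "m \<ge> 7"
    and "kunz_face m F"
    and "\<not> degenerate_face m F"
    and "dim F = d"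
    and "embedding_dim m F = e"
    and "(real d = real m / 2 - 1 \<and> e = m - 2) \<or> (d = 1 \<and> e = m - 3)"
  shows "even m \<and> \<not> apery_face m F"
proof -
  have "face_interior m F \<noteq> {}"
    using assms(2) kunz.relint_nonempty by (simp add: kunz_face_def kunz_cone_eq face_interior_eq)
  then obtain x where x: "x \<in> face_interior m F" by blast
  note * = even_and_noninj[OF assms(1-3) _ assms(6)[folded assms(4,5)]]
  have "\<not> apery_face m F"
    using * apery_imp_inj[OF assms(1-3)] unfolding apery_face_def by blast
  then show ?thesis using *[OF x] by blast
qed

end
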